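(* Let $A\subset\mathbb{R}^3$ be a convex solid. Then $A$ is lonely if and only if $A$ is of constant width.
   Context: A convex solid is a compact convex subset of $\mathbb{R}^3$ with nonempty interior. The width of a solid in a given direction (unit vector $u$) is the distance between its two opposite parallel supporting planes perpendicular to $u$, i.e. $w_A(u)=\max_{x\in A}\langle x,u\rangle-\min_{x\in A}\langle x,u\rangle$. A convex solid has constant width if its width is the same in every direction. A convex solid $A$ can Rupert through a convex solid $B$ if a congruent copy of $A$ can pass, by a rigid translation along some direction, through a straight hole cut through $B$ along that direction, without splitting $B$ (the hole does not reach the lateral boundary of $B$). Precisely: there are unit vectors $u,v\in\mathbb{R}^3$ such that, writing $\pi_u(A)$ for the orthogonal projection of $A$ onto the plane $u^\perp$ and $\pi_v(B)$ for the orthogonal projection of $B$ onto the plane $v^\perp$, some isometric copy of $\pi_u(A)$ in the plane $v^\perp$ (the image of $\pi_u(A)$ under an isometry $u^\perp\to v^\perp$) is contained in the interior of $\pi_v(B)$ relative to $v^\perp$. Two convex solids $A$ and $B$ (possibly $A=B$) are friends if $A$ can Rupert through $B$ and $B$ can Rupert through $A$. A convex solid $A$ is lonely if it has no friends, including itself; that is, there is no convex solid $B$ (with $B=A$ allowed) such that $A$ and $B$ are friends. *)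

theory Defs
  imports "HOL-Analysis.Analysis"
begin

definition convex_solid :: "(real ^ 3) set \<Rightarrow> bool" where
  "convex_solid A \<longleftrightarrow> compact A \<and> convex A \<and> interior A \<noteq> {}"

text \<open>Suprema and infima are used in place of maxima and minima; they are attained when
  \<open>A\<close> is compact and nonempty.\<close>

definition width :: "(real ^ 3) set \<Rightarrow> real ^ 3 \<Rightarrow> real" where
  "width A u = (SUP x\<in>A. x \<bullet> u) - (INF x\<in>A. x \<bullet> u)"

definition constant_width :: "(real ^ 3) set \<Rightarrow> bool" where
  "constant_width A \<longleftrightarrow> (\<exists>w. \<forall>u. norm u = 1 \<longrightarrow> width A u = w)"

text \<open>For a unit vector \<open>u\<close>, the map below is the orthogonal projection onto the plane
  \<open>{u}\<^sup>\<bottom>\<close>.\<close>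

definition proj_perp :: "real ^ 3 \<Rightarrow> real ^ 3 \<Rightarrow> real ^ 3" where
  "proj_perp u x = x - (x \<bullet> u) *\<^sub>R u"

text \<open>Isometries between the two planes are distance-preserving maps: they need not fix the
  origin, and orientation-reversing ones are allowed.  Only the values of \<open>f\<close> on
  \<open>{u}\<^sup>\<bottom>\<close> matter.\<close>

definition plane_isometry :: "real ^ 3 \<Rightarrow> real ^ 3 \<Rightarrow> (real ^ 3 \<Rightarrow> real ^ 3) \<Rightarrow> bool" where
  "plane_isometry u v f \<longleftrightarrow>
     f ` ({u}\<^sup>\<bottom>) = {v}\<^sup>\<bottom> \<and>
     (\<forall>x\<in>{u}\<^sup>\<bottom>. \<forall>y\<in>{u}\<^sup>\<bottom>. dist (f x) (f y) = dist x y)"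

definition can_rupert :: "(real ^ 3) set \<Rightarrow> (real ^ 3) set \<Rightarrow> bool" where
  "can_rupert A B \<longleftrightarrow>
     (\<exists>u v f. norm u = 1 \<and> norm v = 1 \<and> plane_isometry u v f \<and>
        f ` (proj_perp u ` A) \<subseteq> (top_of_set ({v}\<^sup>\<bottom>)) interior_of (proj_perp v ` B))"

definition friends :: "(real ^ 3) set \<Rightarrow> (real ^ 3) set \<Rightarrow> bool" where
  "friends A B \<longleftrightarrow> can_rupert A B \<and> can_rupert B A"

definition lonely :: "(real ^ 3) set \<Rightarrow> bool" where
  "lonely A \<longleftrightarrow> \<not> (\<exists>B. convex_solid B \<and> friends A B)"

end

theory Submission
  imports Defs
begin

text \<open>
  Solids of constant width are lonely because of one remark: if \<open>A\<close> can Rupert through \<open>B\<close> via planes \<open>u\<^sup>\<bottom>\<close> and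
  \<open>v\<^sup>\<bottom>\<close>, then the isometry turns each direction of \<open>u\<^sup>\<bottom>\<close> into a direction of \<open>v\<^sup>\<bottom>\<close>
  along which \<open>B\<close> is strictly wider than \<open>A\<close> was, and all directions of \<open>v\<^sup>\<bottom>\<close> arise in this way
  (\<open>rupert_width_less\<close>, \<open>plane_isometry_directions\<close>).

  Suppose now that \<open>A\<close> has constant width \<open>w\<close> and a friend \<open>B\<close>. Passing \<open>A\<close> through \<open>B\<close> shows that
  \<open>B\<close> has width greater than \<open>w\<close> in all directions of one plane; passing \<open>B\<close> through \<open>A\<close> shows
  that \<open>B\<close> has width less than \<open>w\<close> in all directions of another plane. Two planes through the
  origin in three-space share a direction, which is absurd.

  Suppose conversely that the width of \<open>A\<close> in some direction \<open>e\<close> is less than its width in another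
  direction. The latter width is at most the distance of two points of \<open>A\<close>, so \<open>A\<close> contains a
  segment longer than \<open>width A e\<close>; shrinking that segment towards an interior point gives a
  segment of length exactly \<open>width A e\<close> whose \<open>\<epsilon>\<close>-neighbourhood still lies in \<open>A\<close>
  (\<open>segment_nbhd_in_convex\<close>). Choose a unit vector \<open>v\<close> orthogonal to \<open>e\<close> and to the segment, and a
  unit vector \<open>u\<close> orthogonal to \<open>e\<close> and \<open>v\<close>. As a friend of \<open>A\<close> serves the thin plate \<open>B\<close> consisting
  of all points within a small distance \<open>\<delta>\<close> of the projection of \<open>A\<close> along \<open>u\<close>. Seen along \<open>u\<close>, the
  plate is slightly larger than \<open>A\<close>, so that \<open>A\<close> passes through it. Seen along \<open>v\<close>, that is
  edge-on, it lies within \<open>\<delta>\<close> of a segment of direction \<open>e\<close> and length \<open>width A e\<close>, and a rotated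
  copy of this fits into the neighbourhood found inside \<open>A\<close> (\<open>thin_can_rupert\<close>).
\<close>

section \<open>Planes and projections\<close>

lemma mem_perp_plane: "x \<in> {v}\<^sup>\<bottom> \<longleftrightarrow> x \<bullet> v = 0"
  by (auto simp: orthogonal_comp_def orthogonal_def inner_commute)

lemma proj_perp_in_plane: "norm v = 1 \<Longrightarrow> proj_perp v x \<in> {v}\<^sup>\<bottom>"
  by (simp add: mem_perp_plane proj_perp_def inner_diff_left norm_eq_1)

lemma proj_perp_inner: "v \<bullet> e = 0 \<Longrightarrow> proj_perp v x \<bullet> e = x \<bullet> e"
  by (simp add: proj_perp_def inner_diff_left)

lemma proj_perp_fixes: "x \<bullet> v = 0 \<Longrightarrow> proj_perp v x = x"
  by (simp add: proj_perp_def)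

lemma linear_proj_perp: "linear (proj_perp v)"
  by (rule linearI) (auto simp: proj_perp_def inner_add_left algebra_simps)

lemma norm_proj_perp_le:
  assumes "norm v = 1"
  shows "norm (proj_perp v x) \<le> norm x"
proof -
  have "(norm (proj_perp v x))\<^sup>2 = (norm x)\<^sup>2 - (x \<bullet> v)\<^sup>2"
    unfolding power2_norm_eq_inner using assms
    by (simp add: proj_perp_def inner_diff_left inner_diff_right inner_commute norm_eq_1
        power2_eq_square)
  then have "(norm (proj_perp v x))\<^sup>2 \<le> (norm x)\<^sup>2"
    by simp
  then show ?thesis
    by (rule power2_le_imp_le) simp
qed

lemma common_normal_exists:
  fixes a b :: "real ^ 3"
  obtains v where "norm v = 1" "v \<bullet> a = 0" "v \<bullet> b = 0"
proof -
  have "dim {a, b} \<le> card {a, b}"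
    by (rule dim_le_card) (auto intro: span_base)
  also have "\<dots> \<le> 2"
    by (simp add: card_insert_if)
  finally have "dim {a, b} < DIM(real ^ 3)"
    by simp
  then show thesis
  proof (rule orthogonal_to_subspace_exists)
    fix x :: "real ^ 3"
    assume x: "x \<noteq> 0" "\<And>y. y \<in> span {a, b} \<Longrightarrow> orthogonal x y"
    show thesis
    proof (rule that)
      show "norm (x /\<^sub>R norm x) = 1"
        using x(1) by simp
      show "(x /\<^sub>R norm x) \<bullet> a = 0" "(x /\<^sub>R norm x) \<bullet> b = 0"
        using x(2)[of a] x(2)[of b] by (simp_all add: span_base orthogonal_def)
    qed
  qed
qed

lemma orthonormal_expand:
  fixes u v e :: "real ^ 3"
  assumes "norm u = 1" "norm v = 1" "norm e = 1" "u \<bullet> v = 0" "u \<bullet> e = 0" "v \<bullet> e = 0"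
  shows "x = (x \<bullet> u) *\<^sub>R u + (x \<bullet> v) *\<^sub>R v + (x \<bullet> e) *\<^sub>R e"
proof -
  have ne: "u \<noteq> v" "u \<noteq> e" "v \<noteq> e"
    using assms by (auto simp: norm_eq_1)
  have orth: "pairwise orthogonal {u, v, e}"
    using assms by (auto simp: pairwise_def orthogonal_def inner_commute)
  have "0 \<notin> {u, v, e}"
    using assms by auto
  with orth have "independent {u, v, e}"
    by (rule pairwise_orthogonal_independent)
  moreover have "card {u, v, e} = 3"
    using ne by simp
  ultimately have "UNIV \<subseteq> span {u, v, e}"
    by (intro card_ge_dim_independent) auto
  then have "(\<Sum>i\<in>{u, v, e}. (x \<bullet> i) *\<^sub>R i) = x"
    using assms by (intro orthonormal_basis_expand orth) auto
  then show ?thesis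
    using ne by (simp add: add.assoc)
qed

text \<open>The open set witnessing membership in the relative interior is the union of the given
  balls.\<close>

lemma subset_interior_of_plane:
  assumes "P \<subseteq> W" "r > 0" "\<And>x. x \<in> P \<Longrightarrow> ball x r \<inter> W \<subseteq> Q"
  shows "P \<subseteq> (top_of_set W) interior_of Q"
proof -
  have "openin (top_of_set W) (W \<inter> (\<Union>x\<in>P. ball x r))"
    by (intro openin_open_Int open_UN) auto
  moreover have "W \<inter> (\<Union>x\<in>P. ball x r) \<subseteq> Q"
    using assms(3) by blast
  ultimately have "W \<inter> (\<Union>x\<in>P. ball x r) \<subseteq> (top_of_set W) interior_of Q"
    by (simp add: interior_of_maximal)
  moreover have "P \<subseteq> W \<inter> (\<Union>x\<in>P. ball x r)"
    using assms(1,2) by force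
  ultimately show ?thesis
    by blast
qed

section \<open>Width\<close>

lemma width_ge:
  assumes "compact A" "a \<in> A" "b \<in> A"
  shows "(a - b) \<bullet> u \<le> width A u"
proof -
  have "bounded ((\<lambda>x. x \<bullet> u) ` A)"
    by (intro compact_imp_bounded compact_continuous_image continuous_intros assms)
  then have "a \<bullet> u \<le> (SUP x\<in>A. x \<bullet> u)" "(INF x\<in>A. x \<bullet> u) \<le> b \<bullet> u"
    using assms by (auto intro!: cSUP_upper cINF_lower bounded_imp_bdd_above bounded_imp_bdd_below)
  then show ?thesis
    by (simp add: width_def inner_diff_left)
qed

lemma width_attained:
  assumes "compact A" "A \<noteq> {}"
  shows "\<exists>a\<in>A. \<exists>b\<in>A. width A u = (a - b) \<bullet> u \<and> (\<forall>x\<in>A. b \<bullet> u \<le> x \<bullet> u \<and> x \<bullet> u \<le> a \<bullet> u)"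
proof -
  have cont: "continuous_on A (\<lambda>x. x \<bullet> u)"
    by (intro continuous_intros)
  obtain a where a: "a \<in> A" "\<And>x. x \<in> A \<Longrightarrow> x \<bullet> u \<le> a \<bullet> u"
    using continuous_attains_sup[OF assms cont] by blast
  obtain b where b: "b \<in> A" "\<And>x. x \<in> A \<Longrightarrow> b \<bullet> u \<le> x \<bullet> u"
    using continuous_attains_inf[OF assms cont] by blast
  have "(SUP x\<in>A. x \<bullet> u) = a \<bullet> u" "(INF x\<in>A. x \<bullet> u) = b \<bullet> u"
    using a b by (auto intro!: cSup_eq_maximum cInf_eq_minimum)
  then have "width A u = (a - b) \<bullet> u"
    by (simp add: width_def inner_diff_left)
  with a b show ?thesis
    by blast
qed

section \<open>Passing through a solid increases widths\<close>

text \<open>By polarization, an isometry between planes is an inner product preserving map followed by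
  the translation by its value at the origin.\<close>

lemma plane_isometry_inner:
  assumes "plane_isometry u v f" "x \<in> {u}\<^sup>\<bottom>" "y \<in> {u}\<^sup>\<bottom>"
  shows "(f x - f 0) \<bullet> (f y - f 0) = x \<bullet> y"
proof -
  have 0: "0 \<in> {u}\<^sup>\<bottom>"
    by (simp add: mem_perp_plane)
  have "norm (f a - f b) = norm (a - b)" if "a \<in> {u}\<^sup>\<bottom>" "b \<in> {u}\<^sup>\<bottom>" for a b
    using assms(1) that by (simp add: plane_isometry_def dist_norm)
  from this[OF assms(2) 0] this[OF assms(3) 0] this[OF assms(2,3)]
  have "norm (f x - f 0) = norm x" "norm (f y - f 0) = norm y"
    "norm ((f x - f 0) - (f y - f 0)) = norm (x - y)"
    by simp_all
  then show ?thesis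
    by (simp only: dot_norm_neg)
qed

text \<open>Surjectivity matters here: the direction common to two planes may be prescribed in the
  plane of the hole and has to be traced back to the plane of the solid that passes.\<close>

lemma plane_isometry_directions:
  assumes "plane_isometry u v f"
  shows "(\<lambda>e. f e - f 0) ` {e \<in> {u}\<^sup>\<bottom>. norm e = 1} = {e \<in> {v}\<^sup>\<bottom>. norm e = 1}"
proof -
  have im: "f ` ({u}\<^sup>\<bottom>) = {v}\<^sup>\<bottom>"
    using assms unfolding plane_isometry_def by blast
  have "f 0 \<in> f ` ({u}\<^sup>\<bottom>)"
    by (simp add: mem_perp_plane)
  then have 0: "f 0 \<bullet> v = 0"
    unfolding im by (simp add: mem_perp_plane)
  have nrm: "norm (f e - f 0) = norm e" if "e \<in> {u}\<^sup>\<bottom>" for e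
    using plane_isometry_inner[OF assms that that] by (simp add: norm_eq_sqrt_inner)
  show ?thesis
  proof (intro equalityI subsetI)
    fix d assume "d \<in> (\<lambda>e. f e - f 0) ` {e \<in> {u}\<^sup>\<bottom>. norm e = 1}"
    then obtain e where e: "e \<in> {u}\<^sup>\<bottom>" "norm e = 1" "d = f e - f 0"
      by blast
    then have "f e \<in> {v}\<^sup>\<bottom>"
      using im by blast
    with e nrm[OF e(1)] 0 show "d \<in> {e \<in> {v}\<^sup>\<bottom>. norm e = 1}"
      by (simp add: mem_perp_plane inner_diff_left)
  next
    fix d assume d: "d \<in> {e \<in> {v}\<^sup>\<bottom>. norm e = 1}"
    then have "d + f 0 \<in> f ` ({u}\<^sup>\<bottom>)"
      using im 0 by (simp add: mem_perp_plane inner_add_left)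
    then obtain e where e: "e \<in> {u}\<^sup>\<bottom>" "d + f 0 = f e"
      by blast
    have "d = f e - f 0"
      by (simp flip: e(2))
    moreover have "norm e = 1"
      using nrm[OF e(1)] d by (simp flip: e(2))
    ultimately show "d \<in> (\<lambda>e. f e - f 0) ` {e \<in> {u}\<^sup>\<bottom>. norm e = 1}"
      using e(1) by blast
  qed
qed

text \<open>The two points of \<open>A\<close> that are extreme in direction \<open>e\<close> are carried into the projection of
  \<open>B\<close>; there the upper one can still be pushed a little further, since it is a relative interior
  point.\<close>

lemma rupert_width_less:
  assumes "compact A" "A \<noteq> {}" "compact B" "norm u = 1" "norm v = 1"
    and f: "plane_isometry u v f"
    and sub: "f ` (proj_perp u ` A) \<subseteq> (top_of_set ({v}\<^sup>\<bottom>)) interior_of (proj_perp v ` B)"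
    and e: "e \<in> {u}\<^sup>\<bottom>" "norm e = 1"
  shows "width A e < width B (f e - f 0)"
proof -
  define d where "d = f e - f 0"
  have d: "d \<bullet> v = 0" "norm d = 1"
    using plane_isometry_directions[OF f] e by (auto simp: d_def mem_perp_plane)
  have fd: "f (proj_perp u x) \<bullet> d = x \<bullet> e + f 0 \<bullet> d" for x
  proof -
    have "(f (proj_perp u x) - f 0) \<bullet> d = x \<bullet> e"
      using plane_isometry_inner[OF f proj_perp_in_plane[OF \<open>norm u = 1\<close>] e(1), of x] e(1)
      by (simp add: d_def proj_perp_inner mem_perp_plane inner_commute[of e])
    then show ?thesis
      by (simp add: inner_diff_left)
  qed
  obtain a b where ab: "a \<in> A" "b \<in> A" "width A e = (a - b) \<bullet> e"
    using width_attained[OF assms(1,2), of e] by blast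
  have "openin (top_of_set ({v}\<^sup>\<bottom>)) ((top_of_set ({v}\<^sup>\<bottom>)) interior_of (proj_perp v ` B))"
    by simp
  moreover have "f (proj_perp u a) \<in> (top_of_set ({v}\<^sup>\<bottom>)) interior_of (proj_perp v ` B)"
    using sub ab by blast
  ultimately obtain r where r: "r > 0"
    "ball (f (proj_perp u a)) r \<inter> {v}\<^sup>\<bottom> \<subseteq> (top_of_set ({v}\<^sup>\<bottom>)) interior_of (proj_perp v ` B)"
    unfolding openin_contains_ball by blast
  have "f (proj_perp u a) \<in> {v}\<^sup>\<bottom>"
    using f proj_perp_in_plane[OF \<open>norm u = 1\<close>] by (auto simp: plane_isometry_def)
  then have "f (proj_perp u a) + (r/2) *\<^sub>R d \<in> ball (f (proj_perp u a)) r \<inter> {v}\<^sup>\<bottom>"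
    using d r(1) by (simp add: mem_perp_plane inner_add_left dist_norm)
  then have "f (proj_perp u a) + (r/2) *\<^sub>R d \<in> proj_perp v ` B"
    by (rule subsetD[OF subset_trans[OF r(2) interior_of_subset]])
  then obtain a' where a': "a' \<in> B" "proj_perp v a' = f (proj_perp u a) + (r/2) *\<^sub>R d"
    by force
  have "f (proj_perp u b) \<in> proj_perp v ` B"
    using ab(2) by (intro subsetD[OF subset_trans[OF sub interior_of_subset]] imageI)
  then obtain b' where b': "b' \<in> B" "proj_perp v b' = f (proj_perp u b)"
    by force
  have v: "v \<bullet> d = 0"
    using d by (simp add: inner_commute)
  have "a' \<bullet> d = a \<bullet> e + f 0 \<bullet> d + r/2"
    using arg_cong[OF a'(2), of "\<lambda>x. x \<bullet> d"] d
    by (simp add: proj_perp_inner[OF v] inner_add_left fd norm_eq_1)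
  moreover have "b' \<bullet> d = b \<bullet> e + f 0 \<bullet> d"
    using arg_cong[OF b'(2), of "\<lambda>x. x \<bullet> d"] by (simp add: proj_perp_inner[OF v] fd)
  ultimately have "width A e < (a' - b') \<bullet> d"
    using ab(3) r(1) by (simp add: inner_diff_left)
  also have "\<dots> \<le> width B d"
    by (rule width_ge) fact+
  finally show ?thesis
    by (simp add: d_def)
qed

lemma constant_width_imp_lonely:
  assumes A: "convex_solid A" and "constant_width A"
  shows "lonely A"
  unfolding lonely_def
proof (intro notI, elim exE conjE)
  fix B assume B: "convex_solid B" and "friends A B"
  obtain w where w: "\<And>e. norm e = 1 \<Longrightarrow> width A e = w"
    using assms(2) by (auto simp: constant_width_def)
  have cpt: "compact A" "compact B" "A \<noteq> {}" "B \<noteq> {}"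
    using A B by (auto simp: convex_solid_def)
  obtain u v f where uv: "norm u = 1" "norm v = 1" and f: "plane_isometry u v f"
    "f ` (proj_perp u ` A) \<subseteq> (top_of_set ({v}\<^sup>\<bottom>)) interior_of (proj_perp v ` B)"
    using \<open>friends A B\<close> by (auto simp: friends_def can_rupert_def)
  obtain u' v' g where uv': "norm u' = 1" "norm v' = 1" and g: "plane_isometry u' v' g"
    "g ` (proj_perp u' ` B) \<subseteq> (top_of_set ({v'}\<^sup>\<bottom>)) interior_of (proj_perp v' ` A)"
    using \<open>friends A B\<close> by (auto simp: friends_def can_rupert_def)
  obtain d where d: "norm d = 1" "d \<bullet> v = 0" "d \<bullet> u' = 0"
    by (rule common_normal_exists)
  have "d \<in> (\<lambda>e. f e - f 0) ` {e \<in> {u}\<^sup>\<bottom>. norm e = 1}"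
    unfolding plane_isometry_directions[OF f(1)] using d by (simp add: mem_perp_plane)
  then obtain e where e: "e \<in> {u}\<^sup>\<bottom>" "norm e = 1" "d = f e - f 0"
    by blast
  have "w < width B d"
    using rupert_width_less[OF cpt(1,3,2) uv f e(1,2)] w e by simp
  moreover have "d \<in> {u'}\<^sup>\<bottom>"
    using d by (simp add: mem_perp_plane)
  then have "width B d < width A (g d - g 0)" "norm (g d - g 0) = 1"
    using rupert_width_less[OF cpt(2,4,1) uv' g] plane_isometry_directions[OF g(1)] d(1)
    by auto
  ultimately show False
    using w by simp
qed

section \<open>Fitting a thin set into a hole\<close>

text \<open>The homothety with ratio \<open>w / L\<close> centred at an interior point shrinks the segment to length
  \<open>w\<close> and moves it into the interior, by a uniform margin.\<close>

lemma segment_nbhd_in_convex: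
  fixes A :: "'a::euclidean_space set"
  assumes A: "convex A" "interior A \<noteq> {}" and pq: "p \<in> A" "p + L *\<^sub>R d \<in> A"
    and w: "0 \<le> w" "w < L"
  obtains x0 r where "r > 0" "\<And>s. s \<in> {0..w} \<Longrightarrow> cball (x0 + s *\<^sub>R d) r \<subseteq> A"
proof -
  obtain c \<rho> where c: "\<rho> > 0" "cball c \<rho> \<subseteq> A"
    using A(2) by (auto simp: mem_interior_cball)
  define t where "t = 1 - w / L"
  have t: "0 < t" "t \<le> 1" "(1 - t) * L = w"
    using w by (auto simp: t_def field_simps)
  show thesis
  proof (rule that)
    show "t * \<rho> > 0"
      using t c by simp
    fix s assume s: "s \<in> {0..w}"
    \<comment> \<open>For \<open>w = 0\<close> this gives \<open>\<theta> = 0\<close>, which is still the right parameter.\<close>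
    define \<theta> where "\<theta> = s / w"
    have \<theta>: "0 \<le> \<theta>" "\<theta> \<le> 1" "\<theta> * w = s"
      using s by (auto simp: \<theta>_def divide_le_eq_1)
    have "(1 - \<theta>) *\<^sub>R p + \<theta> *\<^sub>R (p + L *\<^sub>R d) \<in> A"
      using A(1) pq \<theta> by (intro convexD) auto
    then have P: "p + (\<theta> * L) *\<^sub>R d \<in> A"
      by (simp add: algebra_simps)
    show "cball (((1 - t) *\<^sub>R p + t *\<^sub>R c) + s *\<^sub>R d) (t * \<rho>) \<subseteq> A"
    proof
      fix y assume y: "y \<in> cball (((1 - t) *\<^sub>R p + t *\<^sub>R c) + s *\<^sub>R d) (t * \<rho>)"
      define h where "h = y - (((1 - t) *\<^sub>R p + t *\<^sub>R c) + s *\<^sub>R d)"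
      have "norm h \<le> t * \<rho>"
        using y by (simp add: h_def dist_norm norm_minus_commute)
      then have "c + h /\<^sub>R t \<in> A"
        using t c by (intro subsetD[OF c(2)]) (simp add: dist_norm field_simps)
      then have "(1 - t) *\<^sub>R (p + (\<theta> * L) *\<^sub>R d) + t *\<^sub>R (c + h /\<^sub>R t) \<in> A"
        using A(1) P t by (intro convexD) auto
      moreover have "(1 - t) * (\<theta> * L) = s"
        using t(3) \<theta>(3) by (metis mult.left_commute)
      then have "(1 - t) *\<^sub>R (p + (\<theta> * L) *\<^sub>R d) + t *\<^sub>R (c + h /\<^sub>R t) = y"
        using t(1) by (simp add: scaleR_right_distrib h_def)
      ultimately show "y \<in> A"
        by simp
    qed
  qed
qed

text \<open>The reflection in the hyperplane orthogonal to \<open>n\<close>. Isometries of planes may reverse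
  orientation, so this is the simplest isometry that turns one direction into another.\<close>

definition mirror :: "'a::real_inner \<Rightarrow> 'a \<Rightarrow> 'a" where
  "mirror n x = x - (2 * (x \<bullet> n) / (n \<bullet> n)) *\<^sub>R n"

lemma linear_mirror: "linear (mirror n)"
  by (rule linearI)
    (auto simp: mirror_def inner_add_left algebra_simps add_divide_distrib)

lemma norm_mirror: "norm (mirror n x) = norm x"
proof (cases "n = 0")
  case False
  then have "mirror n x \<bullet> mirror n x = x \<bullet> x"
    by (simp add: mirror_def inner_diff_left inner_diff_right inner_commute)
  then show ?thesis
    by (simp add: norm_eq_sqrt_inner)
qed (simp add: mirror_def)

lemma mirror_mirror: "mirror n (mirror n x) = x"
  by (cases "n = 0") (simp_all add: mirror_def inner_diff_left)

lemma mirror_swaps: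
  assumes "norm e = norm d"
  shows "mirror (e - d) e = d"
proof (cases "e = d")
  case False
  have "e \<bullet> e = d \<bullet> d"
    using assms by (simp add: norm_eq)
  then have "2 * (e \<bullet> (e - d)) = (e - d) \<bullet> (e - d)"
    by (simp add: inner_diff_left inner_diff_right inner_commute)
  with False show ?thesis
    by (simp add: mirror_def)
qed (simp add: mirror_def)

lemma mirror_perp: "n \<bullet> v = 0 \<Longrightarrow> mirror n x \<bullet> v = x \<bullet> v"
  by (simp add: mirror_def inner_diff_left)

lemma plane_isometry_mirror:
  assumes "n \<bullet> v = 0" "z \<bullet> v = 0"
  shows "plane_isometry v v (\<lambda>x. mirror n x + z)"
  unfolding plane_isometry_def
proof (intro conjI ballI equalityI subsetI)
  fix y assume "y \<in> {v}\<^sup>\<bottom>"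
  then have "mirror n (y - z) \<in> {v}\<^sup>\<bottom>" "y = mirror n (mirror n (y - z)) + z"
    using assms by (simp_all add: mem_perp_plane mirror_perp mirror_mirror inner_diff_left)
  then show "y \<in> (\<lambda>x. mirror n x + z) ` ({v}\<^sup>\<bottom>)"
    by (rule rev_image_eqI)
next
  fix y assume "y \<in> (\<lambda>x. mirror n x + z) ` ({v}\<^sup>\<bottom>)"
  then show "y \<in> {v}\<^sup>\<bottom>"
    using assms by (auto simp: mem_perp_plane mirror_perp inner_add_left)
next
  fix x y :: "real ^ 3"
  have "norm (mirror n x - mirror n y) = norm (x - y)"
    by (metis linear_diff linear_mirror norm_mirror)
  then show "dist (mirror n x + z) (mirror n y + z) = dist x y"
    by (simp add: dist_norm)
qed

text \<open>The planes of the two projections are taken to be equal; then the isometry reflects \<open>e\<close>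
  to \<open>d\<close> and translates the segment in direction \<open>e\<close>, whose parameters start at \<open>m\<close>, onto
  the projection of the one that starts at \<open>x0\<close>. The margin \<open>2 * r\<close> is spent half on the
  thickness of \<open>B\<close> and half on staying away from the boundary.\<close>

lemma thin_can_rupert:
  assumes v: "norm v = 1" "v \<bullet> e = 0" "v \<bullet> d = 0" and ed: "norm e = norm d" and "r > 0"
    and A: "\<And>s. s \<in> {0..w} \<Longrightarrow> cball (x0 + s *\<^sub>R d) (2 * r) \<subseteq> A"
    and B: "\<And>y. y \<in> B \<Longrightarrow> \<exists>s\<in>{0..w}. norm (proj_perp v y - (m + s) *\<^sub>R e) \<le> r"
  shows "can_rupert B A"
proof -
  define n where "n = e - d"
  define z where "z = proj_perp v x0 - m *\<^sub>R d"
  have ed_v: "e \<bullet> v = 0" "d \<bullet> v = 0"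
    using v(2,3) by (simp_all add: inner_commute)
  then have n: "n \<bullet> v = 0"
    by (simp add: n_def inner_diff_left)
  have z: "z \<bullet> v = 0"
    using ed_v proj_perp_in_plane[OF v(1), of x0]
    by (simp add: z_def mem_perp_plane inner_diff_left)
  have iso: "plane_isometry v v (\<lambda>x. mirror n x + z)"
    using n z by (rule plane_isometry_mirror)
  have "(\<lambda>x. mirror n x + z) ` (proj_perp v ` B)
      \<subseteq> (top_of_set ({v}\<^sup>\<bottom>)) interior_of (proj_perp v ` A)"
  proof (rule subset_interior_of_plane[OF _ \<open>r > 0\<close>])
    show "(\<lambda>x. mirror n x + z) ` (proj_perp v ` B) \<subseteq> {v}\<^sup>\<bottom>"
      using iso proj_perp_in_plane[OF v(1)] by (fastforce simp: plane_isometry_def)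
  next
    fix y' assume "y' \<in> (\<lambda>x. mirror n x + z) ` (proj_perp v ` B)"
    then obtain y where y: "y \<in> B" "y' = mirror n (proj_perp v y) + z"
      by blast
    then obtain s where s: "s \<in> {0..w}" "norm (proj_perp v y - (m + s) *\<^sub>R e) \<le> r"
      using B by blast
    have "mirror n (proj_perp v y - (m + s) *\<^sub>R e) = mirror n (proj_perp v y) - (m + s) *\<^sub>R d"
      using mirror_swaps[OF ed]
      by (simp add: linear_diff[OF linear_mirror] linear_scale[OF linear_mirror] n_def)
    then have near: "norm (mirror n (proj_perp v y) - (m + s) *\<^sub>R d) \<le> r"
      using s(2) by (metis norm_mirror)
    show "ball y' r \<inter> {v}\<^sup>\<bottom> \<subseteq> proj_perp v ` A"
    proof
      fix x assume x: "x \<in> ball y' r \<inter> {v}\<^sup>\<bottom>"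
      define h where "h = x - (proj_perp v x0 + s *\<^sub>R d)"
      have "h = (x - y') + (mirror n (proj_perp v y) - (m + s) *\<^sub>R d)"
        by (simp add: h_def y(2) z_def algebra_simps)
      moreover have "norm (x - y') < r"
        using x by (simp add: dist_norm norm_minus_commute)
      ultimately have "norm h \<le> 2 * r"
        using near by (simp add: norm_triangle_le)
      then have "x0 + s *\<^sub>R d + h \<in> A"
        by (intro subsetD[OF A[OF s(1)]]) (simp add: dist_norm)
      moreover have "(s *\<^sub>R d + h) \<bullet> v = 0"
        using x ed_v proj_perp_in_plane[OF v(1), of x0]
        by (simp add: h_def mem_perp_plane inner_add_left inner_diff_left)
      then have "proj_perp v (s *\<^sub>R d + h) = s *\<^sub>R d + h"
        by (rule proj_perp_fixes)
      then have "proj_perp v (x0 + (s *\<^sub>R d + h)) = proj_perp v x0 + (s *\<^sub>R d + h)"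
        by (simp only: linear_add[OF linear_proj_perp, of v x0])
      then have "proj_perp v (x0 + (s *\<^sub>R d + h)) = x"
        by (simp add: h_def)
      ultimately show "x \<in> proj_perp v ` A"
        by (metis add.assoc imageI)
    qed
  qed
  then show ?thesis
    using iso v(1) by (auto simp: can_rupert_def)
qed

section \<open>A friend for every solid of varying width\<close>

text \<open>The plate around a projection of \<open>A\<close>. It is written as a Minkowski sum, which is
  symmetric in all directions, so that no cylinder over the plane needs to be described.\<close>

definition plate :: "real ^ 3 \<Rightarrow> real \<Rightarrow> (real ^ 3) set \<Rightarrow> (real ^ 3) set" where
  "plate u \<delta> A = (\<Union>x\<in>proj_perp u ` A. \<Union>y\<in>cball 0 \<delta>. {x + y})"

lemma mem_plateI: "a \<in> A \<Longrightarrow> norm y \<le> \<delta> \<Longrightarrow> proj_perp u a + y \<in> plate u \<delta> A"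
  by (force simp: plate_def)

lemma convex_solid_plate:
  assumes "convex_solid A" "\<delta> > 0"
  shows "convex_solid (plate u \<delta> A)"
  unfolding convex_solid_def
proof (intro conjI)
  have A: "compact A" "convex A" "A \<noteq> {}"
    using assms(1) by (auto simp: convex_solid_def)
  have "compact (proj_perp u ` A)"
    using A(1) linear_proj_perp
    by (intro compact_continuous_image linear_continuous_on linear_conv_bounded_linear[THEN iffD1])
  then show "compact (plate u \<delta> A)"
    unfolding plate_def by (intro compact_sums' compact_cball)
  show "convex (plate u \<delta> A)"
    unfolding plate_def using A(2) linear_proj_perp
    by (intro convex_sums convex_cball convex_linear_image)
  obtain a where a: "a \<in> A"
    using A(3) by blast
  have "cball (proj_perp u a) \<delta> \<subseteq> plate u \<delta> A"
  proof
    fix x assume "x \<in> cball (proj_perp u a) \<delta>"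
    then have "norm (x - proj_perp u a) \<le> \<delta>"
      by (simp add: dist_norm norm_minus_commute)
    from mem_plateI[OF a this, of u] show "x \<in> plate u \<delta> A"
      by simp
  qed
  then show "interior (plate u \<delta> A) \<noteq> {}"
    using assms(2) mem_interior_cball by blast
qed

lemma can_rupert_plate:
  assumes u: "norm u = 1" and "\<delta> > 0"
  shows "can_rupert A (plate u \<delta> A)"
proof -
  have "proj_perp u ` A \<subseteq> (top_of_set ({u}\<^sup>\<bottom>)) interior_of (proj_perp u ` plate u \<delta> A)"
  proof (rule subset_interior_of_plane[OF _ \<open>\<delta> > 0\<close>])
    show "proj_perp u ` A \<subseteq> {u}\<^sup>\<bottom>"
      using proj_perp_in_plane[OF u] by blast
    fix p assume "p \<in> proj_perp u ` A"
    then obtain a where a: "a \<in> A" "p = proj_perp u a"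
      by blast
    show "ball p \<delta> \<inter> {u}\<^sup>\<bottom> \<subseteq> proj_perp u ` plate u \<delta> A"
    proof
      fix x assume x: "x \<in> ball p \<delta> \<inter> {u}\<^sup>\<bottom>"
      then have "norm (x - p) \<le> \<delta>"
        by (simp add: dist_norm norm_minus_commute)
      from mem_plateI[OF a(1) this, of u] have "x \<in> plate u \<delta> A"
        using a(2) by simp
      moreover have "proj_perp u x = x"
        using x by (simp add: proj_perp_fixes mem_perp_plane)
      ultimately show "x \<in> proj_perp u ` plate u \<delta> A"
        by (metis imageI)
    qed
  qed
  then have "(\<lambda>x. x) ` (proj_perp u ` A)
      \<subseteq> (top_of_set ({u}\<^sup>\<bottom>)) interior_of (proj_perp u ` plate u \<delta> A)"
    by simp
  moreover have "plane_isometry u u (\<lambda>x. x)"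
    by (simp add: plane_isometry_def)
  ultimately show ?thesis
    unfolding can_rupert_def using u by blast
qed

lemma lonely_imp_constant_width:
  assumes A: "convex_solid A" and "lonely A"
  shows "constant_width A"
proof (rule ccontr)
  assume "\<not> constant_width A"
  then obtain e0 where "norm e0 = 1" "width A e0 \<noteq> width A (axis 1 1)"
    unfolding constant_width_def by blast
  moreover have "norm (axis 1 1 :: real ^ 3) = 1"
    by simp
  ultimately obtain e e' where e: "norm e = 1" "norm e' = 1" "width A e < width A e'"
    by (metis linorder_neq_iff)
  have cpt: "compact A" "A \<noteq> {}" and cvx: "convex A" "interior A \<noteq> {}"
    using A by (auto simp: convex_solid_def)
  obtain p q where pq: "p \<in> A" "q \<in> A" "width A e' = (q - p) \<bullet> e'"
    using width_attained[OF cpt, of e'] by blast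
  define L where "L = norm (q - p)"
  define d where "d = (q - p) /\<^sub>R L"
  have "width A e' \<le> L"
    using norm_cauchy_schwarz[of "q - p" e'] e(2) pq(3) by (simp add: L_def)
  then have wL: "width A e < L"
    using e(3) by simp
  obtain a b where ab: "a \<in> A" "b \<in> A" "width A e = (a - b) \<bullet> e"
    "\<And>x. x \<in> A \<Longrightarrow> b \<bullet> e \<le> x \<bullet> e" "\<And>x. x \<in> A \<Longrightarrow> x \<bullet> e \<le> a \<bullet> e"
    using width_attained[OF cpt, of e] by blast
  have w0: "0 \<le> width A e"
    using ab(3) ab(4)[OF ab(1)] by (simp add: inner_diff_left)
  have "L > 0"
    using wL w0 by linarith
  then have d: "norm d = 1" "p + L *\<^sub>R d = q"
    by (simp_all add: d_def flip: L_def)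
  obtain x0 r where r: "r > 0" "\<And>s. s \<in> {0..width A e} \<Longrightarrow> cball (x0 + s *\<^sub>R d) r \<subseteq> A"
    using segment_nbhd_in_convex[OF cvx pq(1) _ w0 wL, of d] d(2) pq(2) by metis
  obtain v where v: "norm v = 1" "v \<bullet> e = 0" "v \<bullet> d = 0"
    by (rule common_normal_exists)
  obtain u where u: "norm u = 1" "u \<bullet> v = 0" "u \<bullet> e = 0"
    by (rule common_normal_exists)
  define B where "B = plate u (r/2) A"
  have "can_rupert B A"
  proof (rule thin_can_rupert[where v = v and e = e and d = d and r = "r/2" and m = "b \<bullet> e"])
    show "norm e = norm d"
      using e(1) d(1) by simp
    show "r / 2 > 0" and "\<And>s. s \<in> {0..width A e} \<Longrightarrow> cball (x0 + s *\<^sub>R d) (2 * (r/2)) \<subseteq> A"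
      using r by simp_all
    fix y assume "y \<in> B"
    then obtain x h where x: "x \<in> A" "norm h \<le> r/2" "y = proj_perp u x + h"
      by (auto simp: B_def plate_def)
    have "proj_perp v (proj_perp u x) = x - (x \<bullet> u) *\<^sub>R u - (x \<bullet> v) *\<^sub>R v"
      using u by (simp add: proj_perp_def[of v] proj_perp_inner) (simp add: proj_perp_def)
    also have "\<dots> = (x \<bullet> e) *\<^sub>R e"
      using orthonormal_expand[OF u(1) v(1) e(1) u(2,3) v(2), of x] by (simp add: algebra_simps)
    finally have "proj_perp v y - (b \<bullet> e + (x \<bullet> e - b \<bullet> e)) *\<^sub>R e = proj_perp v h"
      by (simp add: x(3) linear_add[OF linear_proj_perp])
    moreover have "norm (proj_perp v h) \<le> r/2"
      using norm_proj_perp_le[OF v(1), of h] x(2) by simp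
    moreover have "x \<bullet> e - b \<bullet> e \<in> {0..width A e}"
      using ab(3) ab(4)[OF x(1)] ab(5)[OF x(1)] by (simp add: inner_diff_left)
    ultimately show "\<exists>s\<in>{0..width A e}. norm (proj_perp v y - (b \<bullet> e + s) *\<^sub>R e) \<le> r/2"
      by metis
  qed (fact v)+
  moreover have "can_rupert A B" "convex_solid B"
    unfolding B_def using u(1) r(1) A by (auto intro: can_rupert_plate convex_solid_plate)
  ultimately show False
    using \<open>lonely A\<close> by (auto simp: lonely_def friends_def)
qed

theorem theorem2:
  fixes A :: "(real ^ 3) set"
  assumes "convex_solid A"
  shows "lonely A \<longleftrightarrow> constant_width A"
  using lonely_imp_constant_width[OF assms] constant_width_imp_lonely[OF assms] by blast

end
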